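(* There is no algorithm (deterministic or zero-error randomized) for the Search on Trees problem that has expected query complexity $o(k\log \mathrm{dist}(s,t))$ for every tree $T=(V,E)$ of pathwidth $k$, every prediction $s\in V$, and every target $t\in V$.
   Context: Search on Trees problem: we are given a finite tree $T=(V,E)$ and a prediction $s\in V$; there is an unknown target $t\in V$. The algorithm may adaptively query any node $x\in V$; the query returns "here" if $x=t$, and otherwise returns the unique neighbor of $x$ lying on the path in $T$ from $x$ to $t$. The algorithm must always output the correct target; its query complexity on a given input is the number of queries (for randomized algorithms, the expectation over internal randomness). $\mathrm{dist}(s,t)$ is the number of edges on the $s$–$t$ path in $T$. Pathwidth: a path decomposition of a graph $G$ is a sequence of vertex sets $B_1,\dots,B_m$ covering $V(G)$ such that every edge lies inside some $B_i$ and for every vertex $v$ the set $\{i:v\in B_i\}$ is an interval; the pathwidth is the minimum over decompositions of $\max_i|B_i|-1$. *)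

theory Defs
  imports "HOL-Probability.Probability" "HOL-Library.Landau_Symbols"
begin

section \<open>Finite trees\<close>

type_synonym 'v graph = "'v set \<times> 'v set set"

abbreviation verts :: "'v graph \<Rightarrow> 'v set" where "verts \<equiv> fst"
abbreviation edges :: "'v graph \<Rightarrow> 'v set set" where "edges \<equiv> snd"

definition finite_simple_graph :: "'v graph \<Rightarrow> bool" where
  "finite_simple_graph G \<longleftrightarrow>
     finite (verts G) \<and> (\<forall>e\<in>edges G. e \<subseteq> verts G \<and> card e = 2)"

definition path_between :: "'v graph \<Rightarrow> 'v \<Rightarrow> 'v list \<Rightarrow> 'v \<Rightarrow> bool" where
  "path_between G x p y \<longleftrightarrow>
     p \<noteq> [] \<and> hd p = x \<and> last p = y \<and> set p \<subseteq> verts G \<and> distinct p \<and>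
     successively (\<lambda>u v. {u, v} \<in> edges G) p"

definition is_cycle :: "'v graph \<Rightarrow> 'v list \<Rightarrow> bool" where
  "is_cycle G c \<longleftrightarrow>
     length c \<ge> 3 \<and> path_between G (hd c) c (last c) \<and> {last c, hd c} \<in> edges G"

definition is_tree :: "'v graph \<Rightarrow> bool" where
  "is_tree T \<longleftrightarrow>
     finite_simple_graph T \<and> verts T \<noteq> {} \<and>
     (\<forall>x\<in>verts T. \<forall>y\<in>verts T. \<exists>p. path_between T x p y) \<and>
     (\<nexists>c. is_cycle T c)"

definition tree_path :: "'v graph \<Rightarrow> 'v \<Rightarrow> 'v \<Rightarrow> 'v list" where
  "tree_path T x y = (THE p. path_between T x p y)"

definition tree_dist :: "'v graph \<Rightarrow> 'v \<Rightarrow> 'v \<Rightarrow> nat" where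
  "tree_dist T x y = length (tree_path T x y) - 1"

section \<open>Pathwidth\<close>

definition path_decomposition :: "'v graph \<Rightarrow> 'v set list \<Rightarrow> bool" where
  "path_decomposition G Bs \<longleftrightarrow>
     \<Union>(set Bs) = verts G \<and>
     (\<forall>e\<in>edges G. \<exists>B\<in>set Bs. e \<subseteq> B) \<and>
     (\<forall>v\<in>verts G. \<exists>a b. {i. i < length Bs \<and> v \<in> Bs ! i} = {a..b})"

definition decomposition_width :: "'v set list \<Rightarrow> nat" where
  "decomposition_width Bs = Max (card ` set Bs) - 1"

text \<open>Used only for graphs with at least one vertex, where some bag is nonempty and the
  truncated subtraction above is harmless.\<close>

definition pathwidth :: "'v graph \<Rightarrow> nat" where
  "pathwidth G = (LEAST w. \<exists>Bs. path_decomposition G Bs \<and> decomposition_width Bs = w)"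

section \<open>Search on trees\<close>

datatype 'v response = Here | Toward 'v

definition respond :: "'v graph \<Rightarrow> 'v \<Rightarrow> 'v \<Rightarrow> 'v response" where
  "respond T t x =
     (if x = t then Here
      else Toward (THE y. {x, y} \<in> edges T \<and> y \<in> set (tree_path T x t)))"

text \<open>A deterministic adaptive search procedure for one given tree and prediction, as a decision
  tree. It may output a vertex that it has not queried.\<close>

datatype 'v strategy = Output 'v | Query 'v "'v response \<Rightarrow> 'v strategy"

primrec queries :: "'v graph \<Rightarrow> 'v \<Rightarrow> 'v strategy \<Rightarrow> 'v list" where
  "queries T t (Output v) = []"
| "queries T t (Query x f) = x # queries T t (f (respond T t x))"

primrec result :: "'v graph \<Rightarrow> 'v \<Rightarrow> 'v strategy \<Rightarrow> 'v" where
  "result T t (Output v) = v"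
| "result T t (Query x f) = result T t (f (respond T t x))"

definition solves :: "'v graph \<Rightarrow> 'v strategy \<Rightarrow> bool" where
  "solves T \<sigma> \<longleftrightarrow> (\<forall>t\<in>verts T. set (queries T t \<sigma>) \<subseteq> verts T \<and> result T t \<sigma> = t)"

text \<open>An algorithm receives the tree, the prediction and a sample of its internal randomness, drawn
  from the probability space \<open>M\<close>. Algorithms that ignore the sample are the deterministic ones.
  Strategies always halt; a randomized procedure that halts only almost surely is covered by
  changing it on a null set, since correctness is required almost surely.\<close>

type_synonym ('r, 'v) algorithm = "'v graph \<Rightarrow> 'v \<Rightarrow> 'r \<Rightarrow> 'v strategy"

definition num_queries :: "('r, 'v) algorithm \<Rightarrow> 'v graph \<Rightarrow> 'v \<Rightarrow> 'v \<Rightarrow> 'r \<Rightarrow> nat" where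
  "num_queries A T s t \<omega> = length (queries T t (A T s \<omega>))"

definition zero_error_algorithm :: "'r measure \<Rightarrow> ('r, 'v) algorithm \<Rightarrow> bool" where
  "zero_error_algorithm M A \<longleftrightarrow>
     prob_space M \<and>
     (\<forall>T s. is_tree T \<and> s \<in> verts T \<longrightarrow>
        (AE \<omega> in M. solves T (A T s \<omega>)) \<and>
        (\<forall>t\<in>verts T. num_queries A T s t \<in> measurable M (count_space UNIV)))"

definition expected_queries ::
    "'r measure \<Rightarrow> ('r, 'v) algorithm \<Rightarrow> 'v graph \<Rightarrow> 'v \<Rightarrow> 'v \<Rightarrow> ennreal" where
  "expected_queries M A T s t = (\<integral>\<^sup>+\<omega>. of_nat (num_queries A T s t \<omega>) \<partial>M)"

text \<open>Expected query complexity \<open>o(k log dist(s,t))\<close>. The filter \<open>F\<close> on pairs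
  (pathwidth, distance) is the limit in which the two-parameter little-o is understood.
  For \<open>F = K \<times>\<^sub>F at_top\<close> the distance tends to infinity and \<open>K\<close> describes the pathwidth:
  \<open>K = at_top\<close> is the joint limit, \<open>K = principal {k}\<close> is a fixed pathwidth, and
  \<open>K = principal {1..}\<close> is uniformity in the pathwidth.
  The bound \<open>g\<close> is compared in \<open>ennreal\<close>, so an infinite expectation is never small.\<close>

definition complexity_little_o_k_log_dist ::
    "'r measure \<Rightarrow> ('r, 'v) algorithm \<Rightarrow> (nat \<times> nat) filter \<Rightarrow> bool" where
  "complexity_little_o_k_log_dist M A F \<longleftrightarrow>
     (\<exists>g :: nat \<times> nat \<Rightarrow> real.
        g \<in> o[F](\<lambda>(k, d). real k * ln (real d)) \<and>
        (\<forall>\<^sub>F (k, d) in F. \<forall>T s t.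
           is_tree T \<and> pathwidth T = k \<and> s \<in> verts T \<and> t \<in> verts T \<and> tree_dist T s t = d \<longrightarrow>
           expected_queries M A T s t \<le> ennreal (g (k, d))))"

end

theory Submission
  imports Defs
begin

text \<open>In a tree of bounded degree every query has boundedly many answers, so a strategy that finds
  each of \<open>n\<close> targets needs on average at least a constant times \<open>ln n\<close> queries, whatever the
  prediction. For pathwidth \<open>k\<close> there are binary trees with at least \<open>L ^ k\<close> vertices, all at
  distance at most \<open>(k + 1) * L\<close> from the root: iterated combs, where a comb of level \<open>k\<close> hangs
  combs of level \<open>k - 1\<close> along a backbone of length \<open>L\<close>. For large \<open>L\<close> the average is of order
  \<open>k * ln L\<close>, and so is the logarithm of the distance times \<open>k\<close>. As only finitely many vertices
  lie close to the root, the targets may be required to be far away from it.\<close>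

section \<open>Subtrees of the infinite binary tree\<close>

text \<open>Heap numbering: the root is 1 and the children of \<open>v\<close> are
  \<open>2 * v\<close> and \<open>2 * v + 1\<close>, so that ancestors, depths and subtrees become
  arithmetic with \<open>div 2\<close>.\<close>

definition heap_graph :: "nat set \<Rightarrow> nat graph" where
  "heap_graph U = (U, {{v, v div 2} | v. v \<in> U \<and> v div 2 \<in> U})"

definition heap_closed :: "nat set \<Rightarrow> bool" where
  "heap_closed U \<longleftrightarrow> finite U \<and> 1 \<in> U \<and> 0 \<notin> U \<and> (\<forall>v\<in>U. v > 1 \<longrightarrow> v div 2 \<in> U)"

lemma verts_heap_graph [simp]: "verts (heap_graph U) = U"
  by (simp add: heap_graph_def)

lemma edge_heap_graph_iff:
  "{u, v} \<in> edges (heap_graph U) \<longleftrightarrow> u \<in> U \<and> v \<in> U \<and> (u = v div 2 \<or> v = u div 2)"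
  by (auto simp: heap_graph_def doubleton_eq_iff)

lemma finite_simple_heap_graph:
  assumes "heap_closed U"
  shows "finite_simple_graph (heap_graph U)"
proof -
  have "card {v, v div 2} = 2" if "v \<in> U" for v
  proof -
    have "v \<noteq> 0" using that assms by (metis heap_closed_def)
    then show ?thesis by (simp add: card_insert_if)
  qed
  then show ?thesis
    using assms by (auto simp: finite_simple_graph_def heap_graph_def heap_closed_def)
qed

section \<open>Connectedness and acyclicity\<close>

lemma path_between_singleton: "x \<in> verts G \<Longrightarrow> path_between G x [x] x"
  by (simp add: path_between_def)

lemma path_between_snoc:
  assumes "path_between G x p y" "{y, z} \<in> edges G" "z \<in> verts G" "z \<notin> set p"
  shows "path_between G x (p @ [z]) z"
  using assms by (auto simp: path_between_def successively_append_iff)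

text \<open>A new vertex is appended; if \<open>z\<close> is already on the path, the path is cut at
  \<open>z\<close>, which keeps its vertices distinct.\<close>

lemma path_between_step:
  assumes "path_between G x p y" "{y, z} \<in> edges G" "z \<in> verts G"
  shows "\<exists>q. path_between G x q z"
proof (cases "z \<in> set p")
  case True
  then obtain a b where "p = (a @ [z]) @ b"
    by (metis append.assoc append_Cons append_Nil split_list)
  then have "path_between G x (a @ [z]) z"
    using assms(1) by (auto simp: path_between_def successively_append_iff hd_append)
  then show ?thesis by blast
next
  case False
  then show ?thesis using path_between_snoc assms by metis
qed

lemma path_between_if_rtranclp:
  assumes "(\<lambda>u v. {u, v} \<in> edges G \<and> v \<in> verts G)\<^sup>*\<^sup>* x y" "x \<in> verts G"
  shows "\<exists>p. path_between G x p y"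
  using assms
proof (induction rule: rtranclp_induct)
  case base
  then show ?case using path_between_singleton by metis
next
  case (step y z)
  then show ?case using path_between_step by metis
qed

text \<open>Repeated halving leads from any vertex to the root, and edges can be walked both ways,
  so a walk through the root joins any two vertices.\<close>

lemma heap_graph_connected:
  assumes "heap_closed U" "x \<in> U" "y \<in> U"
  shows "\<exists>p. path_between (heap_graph U) x p y"
proof -
  let ?R = "\<lambda>u v. {u, v} \<in> edges (heap_graph U) \<and> v \<in> verts (heap_graph U)"
  have up_down: "?R\<^sup>*\<^sup>* v 1 \<and> ?R\<^sup>*\<^sup>* 1 v" if "v \<in> U" for v
    using that
  proof (induction v rule: less_induct)
    case (less v)
    show ?case
    proof (cases "v > 1")
      case True
      then have m: "v div 2 \<in> U" using assms(1) less.prems by (simp add: heap_closed_def)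
      then have IH: "?R\<^sup>*\<^sup>* (v div 2) 1 \<and> ?R\<^sup>*\<^sup>* 1 (v div 2)" using less.IH True by simp
      have "?R v (v div 2)" "?R (v div 2) v"
        using m less.prems by (simp_all add: edge_heap_graph_iff)
      then show ?thesis
        using IH converse_rtranclp_into_rtranclp[of ?R v "v div 2" 1]
          rtranclp.rtrancl_into_rtrancl[of ?R 1 "v div 2" v] by blast
    next
      case False
      then have "v = 1" using assms(1) less.prems
        by (metis heap_closed_def less_one linorder_neqE_nat)
      then show ?thesis by simp
    qed
  qed
  have "?R\<^sup>*\<^sup>* x y" using up_down[OF assms(2)] up_down[OF assms(3)] by (meson rtranclp_trans)
  then show ?thesis by (rule path_between_if_rtranclp) (simp add: assms(2))
qed

text \<open>The largest vertex of a cycle would have two distinct smaller neighbours, but its only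
  smaller neighbour is its parent.\<close>

lemma heap_graph_acyclic:
  assumes "heap_closed U"
  shows "\<not> is_cycle (heap_graph U) c"
proof
  assume cyc: "is_cycle (heap_graph U) c"
  define n where "n = length c"
  have n3: "n \<ge> 3" and dist: "distinct c"
    and succ: "successively (\<lambda>u v. {u, v} \<in> edges (heap_graph U)) c"
    and close: "{last c, hd c} \<in> edges (heap_graph U)" and ne: "c \<noteq> []"
    using cyc by (auto simp: is_cycle_def path_between_def n_def)
  have adj: "{c ! j, c ! (Suc j mod n)} \<in> edges (heap_graph U)" if "j < n" for j
  proof (cases "Suc j < n")
    case True
    then show ?thesis using succ by (simp add: successively_conv_nth n_def)
  next
    case False
    then have "j = n - 1" "Suc j mod n = 0" using that by (auto simp: mod_Suc)
    then show ?thesis using close ne by (simp add: last_conv_nth hd_conv_nth n_def)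
  qed
  obtain i where i: "i < n" "c ! i = Max (set c)"
    using Max_in[of "set c"] ne by (metis List.finite_set in_set_conv_nth n_def set_empty)
  \<comment> \<open>\<open>j\<close> and \<open>l\<close> are the cyclic predecessor and successor
    of the position \<open>i\<close> of the maximum; they differ because
    \<open>n \<ge> 3\<close>.\<close>
  define j where "j = (if i = 0 then n - 1 else i - 1)"
  define l where "l = Suc i mod n"
  have j: "j < n" "Suc j mod n = i" using i n3 by (auto simp: j_def)
  have l: "l < n" using n3 by (simp add: l_def)
  have "l \<noteq> j"
  proof (cases "Suc i < n")
    case True
    then show ?thesis using n3 by (auto simp: j_def l_def)
  next
    case False
    then have "Suc i = n" using i by simp
    then show ?thesis using n3 by (auto simp: j_def l_def)
  qed
  have parent: "c ! a = c ! i div 2"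
    if "a < n" "{c ! i, c ! a} \<in> edges (heap_graph U)" for a
  proof -
    have "c ! a \<le> c ! i" using that(1) i by (simp add: n_def)
    moreover have "c ! a \<noteq> 0"
      using that(2) assms by (metis edge_heap_graph_iff heap_closed_def)
    ultimately show ?thesis using that(2) by (auto simp: edge_heap_graph_iff)
  qed
  have "c ! l = c ! i div 2" using parent[OF l] adj[OF i(1)] by (simp add: l_def)
  moreover have "c ! j = c ! i div 2"
    using parent[OF j(1)] adj[OF j(1)] by (simp add: j insert_commute)
  ultimately show False using \<open>l \<noteq> j\<close> dist j l by (metis n_def nth_eq_iff_index_eq)
qed

lemma is_tree_heap_graph:
  assumes "heap_closed U"
  shows "is_tree (heap_graph U)"
  unfolding is_tree_def
  using finite_simple_heap_graph[OF assms] heap_graph_connected[OF assms]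
    heap_graph_acyclic[OF assms] assms
  by (auto simp: heap_closed_def)

section \<open>Paths from the root and distances to it\<close>

lemma root_path_descends:
  assumes "heap_closed U" "path_between (heap_graph U) 1 p t" "Suc i < length p"
  shows "p ! Suc i div 2 = p ! i"
  using assms(3)
proof (induction i)
  case 0
  have "{p ! 0, p ! 1} \<in> edges (heap_graph U)" "p ! 0 = 1"
    using assms(2) 0 by (auto simp: path_between_def successively_conv_nth hd_conv_nth)
  \<comment> \<open>The only smaller neighbour of 1 could be 0, which is not a vertex, so the path
    starts downwards.\<close>
  moreover have "p ! 1 \<noteq> 0"
    using assms(1) \<open>{p ! 0, p ! 1} \<in> _\<close> by (metis edge_heap_graph_iff heap_closed_def)
  ultimately show ?case by (auto simp: edge_heap_graph_iff)
next
  case (Suc i)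
  then have "p ! Suc i div 2 = p ! i" by simp
  \<comment> \<open>Turning upwards would revisit the vertex just left.\<close>
  moreover have "p ! Suc (Suc i) \<noteq> p ! i"
    using assms(2) Suc.prems by (simp add: path_between_def nth_eq_iff_index_eq)
  moreover have "{p ! Suc i, p ! Suc (Suc i)} \<in> edges (heap_graph U)"
    using assms(2) Suc.prems by (simp add: path_between_def successively_conv_nth)
  ultimately show ?case by (auto simp: edge_heap_graph_iff)
qed

lemma root_path_nth:
  assumes "heap_closed U" "path_between (heap_graph U) 1 p t" "i + j < length p"
  shows "p ! i = p ! (i + j) div 2 ^ j"
  using assms(3)
proof (induction j)
  case (Suc j)
  then have "p ! i = p ! (i + j) div 2 ^ j" by simp
  also have "p ! (i + j) = p ! (i + Suc j) div 2"
    using root_path_descends[OF assms(1,2), of "i + j"] Suc.prems by simp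
  finally show ?case by (simp add: div_mult2_eq)
qed simp

text \<open>Halving \<open>t\<close> once per edge ends at the root 1, so \<open>length p\<close> is
  the number of binary digits of \<open>t\<close>.\<close>

lemma root_path_length:
  assumes "heap_closed U" "path_between (heap_graph U) 1 p t"
  shows "2 ^ (length p - 1) \<le> t" "t < 2 ^ length p"
proof -
  have ne: "p \<noteq> []" and "p ! 0 = 1" and "p ! (length p - 1) = t"
    using assms(2) by (auto simp: path_between_def hd_conv_nth last_conv_nth)
  then have *: "t div 2 ^ (length p - 1) = 1"
    using root_path_nth[OF assms, of 0 "length p - 1"] by simp
  show "2 ^ (length p - 1) \<le> t"
    using * by (metis div_less linorder_not_le zero_neq_one)
  have "t < 2 * 2 ^ (length p - 1)"
    using * by (metis div_less_iff_less_mult one_less_numeral_iff semiring_norm(76) zero_less_numeral zero_less_power)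
  then show "t < 2 ^ length p" using ne by (cases p) auto
qed

text \<open>The endpoint determines the length and, by halving, every vertex of the path. This makes
  the definite description in \<open>tree_path\<close> meaningful for paths from the root.\<close>

lemma root_path_unique:
  assumes "heap_closed U" "path_between (heap_graph U) 1 p t" "path_between (heap_graph U) 1 q t"
  shows "p = q"
proof -
  have ne: "p \<noteq> []" "q \<noteq> []" using assms(2,3) by (auto simp: path_between_def)
  have "(2::nat) ^ (length p - 1) < 2 ^ length q" "(2::nat) ^ (length q - 1) < 2 ^ length p"
    using root_path_length[OF assms(1,2)] root_path_length[OF assms(1,3)]
    by linarith+
  then have len: "length p = length q" using ne by simp
  moreover have "p ! i = q ! i" if "i < length p" for i
  proof -
    have "p ! (length p - 1) = t" "q ! (length p - 1) = t"
      using assms(2,3) ne len by (auto simp: path_between_def last_conv_nth)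
    then show ?thesis
      using root_path_nth[OF assms(1,2), of i "length p - 1 - i"]
        root_path_nth[OF assms(1,3), of i "length p - 1 - i"] that len by simp
  qed
  ultimately show ?thesis by (simp add: nth_equalityI)
qed

lemma tree_dist_root_bounds:
  assumes "heap_closed U" "t \<in> U"
  shows "2 ^ tree_dist (heap_graph U) 1 t \<le> t" "t < 2 ^ Suc (tree_dist (heap_graph U) 1 t)"
proof -
  obtain p where p: "path_between (heap_graph U) 1 p t"
    using heap_graph_connected[OF assms(1) _ assms(2)] assms(1) by (metis heap_closed_def)
  then have "tree_path (heap_graph U) 1 t = p"
    unfolding tree_path_def using root_path_unique[OF assms(1)] by (metis the_equality)
  then have "tree_dist (heap_graph U) 1 t = length p - 1" by (simp add: tree_dist_def)
  moreover have "p \<noteq> []" using p by (simp add: path_between_def)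
  ultimately show "2 ^ tree_dist (heap_graph U) 1 t \<le> t"
      "t < 2 ^ Suc (tree_dist (heap_graph U) 1 t)"
    using root_path_length[OF assms(1) p] by simp_all
qed

text \<open>There are really at most four responses to a query. Counting instead all sets of neighbours
  that \<open>respond\<close> may pass to the definite description gives nine, which suffices and does
  not require unique paths between arbitrary vertices.\<close>

lemma heap_graph_responses:
  obtains R where "finite R" "card R \<le> 9" "\<And>t. respond (heap_graph U) t x \<in> R"
proof
  let ?N = "{x div 2, 2 * x, 2 * x + 1}"
  let ?R = "insert Here ((\<lambda>P. Toward (THE y. y \<in> P)) ` Pow ?N)"
  show "finite ?R" by simp
  have "card ?N \<le> 3" by (simp add: card_insert_if)
  then have "card (Pow ?N) \<le> 2 ^ 3" by (subst card_Pow) (simp_all only: finite.intros, rule power_increasing, simp_all)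
  then have "card ((\<lambda>P. Toward (THE y. y \<in> P)) ` Pow ?N) \<le> 8"
    using card_image_le[of "Pow ?N" "\<lambda>P. Toward (THE y. y \<in> P)"] by simp
  moreover have "card ?R \<le> Suc (card ((\<lambda>P. Toward (THE y. y \<in> P)) ` Pow ?N))"
    by (rule card_insert_le_m1) simp_all
  ultimately show "card ?R \<le> 9" by linarith
  show "respond (heap_graph U) t x \<in> ?R" for t
  proof (cases "x = t")
    case False
    let ?P = "{y. {x, y} \<in> edges (heap_graph U) \<and> y \<in> set (tree_path (heap_graph U) x t)}"
    have "?P \<subseteq> ?N" by (auto simp: edge_heap_graph_iff)
    moreover have "respond (heap_graph U) t x = Toward (THE y. y \<in> ?P)"
      using False by (simp add: respond_def)
    ultimately show ?thesis by blast
  qed (simp add: respond_def)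
qed

section \<open>Average number of queries\<close>

text \<open>Kraft's inequality for a decision tree with branching at most \<open>b\<close>. Targets
  are grouped by the first response; by induction each of the at most \<open>b\<close> groups weighs
  at most \<open>1 / b\<close>. An output is correct for one target only.\<close>

lemma strategy_kraft:
  fixes b :: nat
  assumes resp: "\<And>x. \<exists>R. finite R \<and> card R \<le> b \<and> (\<forall>t. respond T t x \<in> R)"
    and "finite S" "\<forall>t\<in>S. result T t \<sigma> = t" "b > 0"
  shows "(\<Sum>t\<in>S. (1 / real b) ^ length (queries T t \<sigma>)) \<le> 1"
  using assms(2,3)
proof (induction \<sigma> arbitrary: S)
  case (Output v)
  then have "S \<subseteq> {v}" by auto
  then show ?case by (auto simp: subset_singleton_iff)
next
  case (Query x f)
  obtain R where R: "finite R" "card R \<le> b" "\<And>t. respond T t x \<in> R" using resp by metis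
  let ?w = "\<lambda>t. (1 / real b) ^ length (queries T t (Query x f))"
  have "(\<Sum>t\<in>S. ?w t) = (\<Sum>\<rho>\<in>R. \<Sum>t\<in>{t\<in>S. respond T t x = \<rho>}. ?w t)"
    using R Query.prems(1) by (subst sum.group) auto
  also have "\<dots> \<le> (\<Sum>\<rho>\<in>R. 1 / real b)"
  proof (rule sum_mono)
    fix \<rho> assume "\<rho> \<in> R"
    let ?S = "{t\<in>S. respond T t x = \<rho>}"
    have "(\<Sum>t\<in>?S. ?w t) = (1 / real b) * (\<Sum>t\<in>?S. (1 / real b) ^ length (queries T t (f \<rho>)))"
      unfolding sum_distrib_left by (rule sum.cong) auto
    also have "(\<Sum>t\<in>?S. (1 / real b) ^ length (queries T t (f \<rho>))) \<le> 1"
      using Query.prems by (intro Query.IH) auto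
    finally show "(\<Sum>t\<in>?S. ?w t) \<le> 1 / real b" by (simp add: mult_left_mono divide_right_mono)
  qed
  also have "\<dots> \<le> 1" using R(2) \<open>b > 0\<close> by (simp add: field_simps)
  finally show ?case .
qed

text \<open>Jensen's inequality for Kraft's sum, in the form \<open>1 + y \<le> exp y\<close> with
  \<open>y = ln n - len * ln b\<close>.\<close>

lemma strategy_total_queries:
  fixes b :: nat
  assumes "\<And>x. \<exists>R. finite R \<and> card R \<le> b \<and> (\<forall>t. respond T t x \<in> R)"
    and "finite S" "\<forall>t\<in>S. result T t \<sigma> = t" "b > 1"
  shows "real (card S) * ln (real (card S)) / ln (real b) \<le> (\<Sum>t\<in>S. real (length (queries T t \<sigma>)))"
proof (cases "S = {}")
  case False
  let ?n = "real (card S)" and ?len = "\<lambda>t. real (length (queries T t \<sigma>))"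
  have n: "?n > 0" using False assms(2) by (simp add: card_gt_0_iff)
  have b: "real b > 1" "ln (real b) > 0" using assms(4) by auto
  have "(\<Sum>t\<in>S. 1 + (ln ?n - ?len t * ln (real b))) \<le> (\<Sum>t\<in>S. exp (ln ?n - ?len t * ln (real b)))"
    by (intro sum_mono exp_ge_add_one_self)
  also have "\<dots> = (\<Sum>t\<in>S. ?n * (1 / real b) ^ length (queries T t \<sigma>))"
    using n b by (intro sum.cong) (auto simp: exp_diff exp_of_nat_mult power_divide)
  also have "\<dots> \<le> ?n * 1"
    unfolding sum_distrib_left[symmetric]
    using assms by (intro mult_left_mono strategy_kraft) auto
  \<comment> \<open>The summands 1 add up to \<open>?n\<close> and cancel the right-hand
    side.\<close>
  finally have "?n * ln ?n \<le> (\<Sum>t\<in>S. ?len t) * ln (real b)"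
    by (simp add: sum.distrib sum_subtractf sum_distrib_right distrib_left)
  then show ?thesis using b by (simp add: field_simps)
qed simp

text \<open>The easy direction of Yao's principle for uniform targets in \<open>S\<close>: almost
  every sample gives a correct strategy, to which the deterministic bound applies; the finite sum is
  then exchanged with the integral.\<close>

lemma total_expected_queries_ge:
  fixes b :: nat
  assumes resp: "\<And>x. \<exists>R. finite R \<and> card R \<le> b \<and> (\<forall>t. respond T t x \<in> R)"
    and alg: "zero_error_algorithm M A" and T: "is_tree T" "s \<in> verts T"
    and S: "S \<subseteq> verts T" and b: "b > 1"
  shows "ennreal (real (card S) * ln (real (card S)) / ln (real b))
    \<le> (\<Sum>t\<in>S. expected_queries M A T s t)"
proof -
  interpret prob_space M using alg by (simp add: zero_error_algorithm_def)
  let ?c = "real (card S) * ln (real (card S)) / ln (real b)"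
  have fin: "finite S"
    using T(1) S finite_subset by (auto simp: is_tree_def finite_simple_graph_def)
  have ae: "AE \<omega> in M. solves T (A T s \<omega>)" using alg T unfolding zero_error_algorithm_def by blast
  have meas: "num_queries A T s t \<in> measurable M (count_space UNIV)" if "t \<in> S" for t
    using alg T S that unfolding zero_error_algorithm_def by blast
  have "ennreal ?c = (\<integral>\<^sup>+\<omega>. ennreal ?c \<partial>M)" by (simp add: emeasure_space_1)
  also have "\<dots> \<le> (\<integral>\<^sup>+\<omega>. (\<Sum>t\<in>S. of_nat (num_queries A T s t \<omega>)) \<partial>M)"
  proof (rule nn_integral_mono_AE, use ae in eventually_elim)
    fix \<omega> assume "solves T (A T s \<omega>)"
    then have "?c \<le> (\<Sum>t\<in>S. real (length (queries T t (A T s \<omega>))))"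
      using S by (intro strategy_total_queries resp fin b) (auto simp: solves_def)
    then have "ennreal ?c \<le> ennreal (\<Sum>t\<in>S. real (num_queries A T s t \<omega>))"
      by (intro ennreal_leI) (simp add: num_queries_def)
    also have "\<dots> = (\<Sum>t\<in>S. of_nat (num_queries A T s t \<omega>))"
      by (subst sum_ennreal[symmetric]) (simp_all add: ennreal_of_nat_eq_real_of_nat)
    finally show "ennreal ?c \<le> (\<Sum>t\<in>S. of_nat (num_queries A T s t \<omega>))" .
  qed
  also have "\<dots> = (\<Sum>t\<in>S. expected_queries M A T s t)"
    unfolding expected_queries_def
  proof (rule nn_integral_sum)
    fix t assume "t \<in> S"
    show "(\<lambda>\<omega>. of_nat (num_queries A T s t \<omega>) :: ennreal) \<in> borel_measurable M"
      using measurable_compose[OF meas[OF \<open>t \<in> S\<close>], of of_nat borel] by simp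
  qed
  finally show ?thesis .
qed

section \<open>Iterated combs\<close>

text \<open>The vertex \<open>r\<close> starts a backbone of length \<open>l\<close> running to right children; the left child
  of every backbone vertex but the last is the root of a copy of the comb of level \<open>k - 1\<close> with
  backbone length \<open>L\<close>.\<close>

fun comb :: "nat \<Rightarrow> nat \<Rightarrow> nat \<Rightarrow> nat \<Rightarrow> nat set" where
  "comb L 0 l r = {r}"
| "comb L (Suc k) 0 r = {r}"
| "comb L (Suc k) (Suc l) r = insert r (comb L k L (2 * r) \<union> comb L (Suc k) l (2 * r + 1))"

section \<open>Depth, disjointness and size of combs\<close>

lemma finite_comb [simp]: "finite (comb L k l r)"
  by (induction L k l r rule: comb.induct) auto

lemma root_in_comb [simp]: "r \<in> comb L k l r"
  by (induction L k l r rule: comb.induct) auto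

lemma comb_parent: "v \<in> comb L k l r \<Longrightarrow> v \<noteq> r \<Longrightarrow> v div 2 \<in> comb L k l r"
proof (induction L k l r rule: comb.induct)
  case (3 L k l r)
  have "2 * r div 2 = r" "(2 * r + 1) div 2 = r" by simp_all
  then show ?case using 3 by (cases "v = 2 * r \<or> v = 2 * r + 1") auto
qed auto

lemma comb_ge: "v \<in> comb L k l r \<Longrightarrow> r \<le> v"
  by (induction L k l r rule: comb.induct) force+

lemma comb_descendant: "v \<in> comb L k l r \<Longrightarrow> \<exists>j. v div 2 ^ j = r"
proof (induction L k l r rule: comb.induct)
  case (3 L k l r)
  have step: "\<exists>j. v div 2 ^ j = r" if "v div 2 ^ j div 2 = r" for j
    using that by (metis div_mult2_eq power_Suc2)
  show ?case
  proof (cases "v = r")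
    case True
    then show ?thesis by (intro exI[of _ 0]) simp
  next
    case False
    then have "(\<exists>j. v div 2 ^ j = 2 * r) \<or> (\<exists>j. v div 2 ^ j = 2 * r + 1)"
      using 3 by auto
    then obtain j where "v div 2 ^ j = 2 * r \<or> v div 2 ^ j = 2 * r + 1" by blast
    then have "v div 2 ^ j div 2 = r" by auto
    then show ?thesis by (rule step)
  qed
qed (auto intro: exI[of _ 0])

text \<open>The exponent bounds the depth of the comb below \<open>r\<close>, and descendants of
  \<open>r\<close> at depth \<open>d\<close> are smaller than
  \<open>(r + 1) * 2 ^ d\<close>.\<close>

lemma comb_lt: "v \<in> comb L k l r \<Longrightarrow> v < (r + 1) * 2 ^ (k * L + l)"
proof (induction L k l r rule: comb.induct)
  case (3 L k l r)
  consider "v = r" | "v \<in> comb L k L (2 * r)" | "v \<in> comb L (Suc k) l (2 * r + 1)"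
    using "3.prems" by auto
  then show ?case
  proof cases
    case 1
    have "(r + 1) * 1 \<le> (r + 1) * 2 ^ (Suc k * L + Suc l)" by (intro mult_le_mono2) simp
    then show ?thesis using 1 by simp
  next
    case 2
    then have "v < (2 * r + 1) * 2 ^ (k * L + L)" using 3 by simp
    also have "\<dots> \<le> (2 * (r + 1)) * 2 ^ (k * L + L + l)"
      by (intro mult_le_mono power_increasing) simp_all
    finally show ?thesis by (simp add: algebra_simps)
  next
    case 3
    then have "v < (2 * r + 1 + 1) * 2 ^ (Suc k * L + l)" using "3.IH" by simp
    then show ?thesis by (simp add: algebra_simps)
  qed
next
  case (1 L l r)
  have "(r + 1) * 1 \<le> (r + 1) * 2 ^ l" by (intro mult_le_mono2) simp
  then show ?case using 1 by simp
next
  case (2 L k r)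
  have "(r + 1) * 1 \<le> (r + 1) * 2 ^ (Suc k * L + 0)" by (intro mult_le_mono2) simp
  then show ?case using 2 by simp
qed

text \<open>If the exponents differ, the larger one continues the halving past the other child and
  ends at most at \<open>r\<close>, which lies below both children as \<open>r > 0\<close>.\<close>

lemma descendants_disjoint:
  fixes v r :: nat
  assumes "r > 0" "v div 2 ^ i = 2 * r" "v div 2 ^ j = 2 * r + 1"
  shows False
proof (cases i j rule: linorder_cases)
  case less
  then obtain m where "j = Suc (i + m)" using less_imp_Suc_add by blast
  then have "(2::nat) ^ j = 2 ^ i * 2 * 2 ^ m" by (simp add: power_add)
  then have "v div 2 ^ j = v div 2 ^ i div 2 div 2 ^ m" by (simp only: div_mult2_eq)
  also have "\<dots> = r div 2 ^ m" using assms(2) by simp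
  also have "\<dots> \<le> r" by simp
  finally show False using assms(3) by simp
next
  case greater
  then obtain m where "i = Suc (j + m)" using less_imp_Suc_add by blast
  then have "(2::nat) ^ i = 2 ^ j * 2 * 2 ^ m" by (simp add: power_add)
  then have "v div 2 ^ i = v div 2 ^ j div 2 div 2 ^ m" by (simp only: div_mult2_eq)
  also have "\<dots> = r div 2 ^ m" using assms(3) by simp
  also have "\<dots> \<le> r" by simp
  finally show False using assms(1,2) by simp
qed (use assms in simp)

lemma comb_disjoint:
  "r > 0 \<Longrightarrow> comb L k l (2 * r) \<inter> comb L' k' l' (2 * r + 1) = {}"
  using comb_descendant descendants_disjoint by (metis disjoint_iff)

lemma root_notin_comb:
  assumes "r < r'" shows "r \<notin> comb L k l r'"
  using assms comb_ge linorder_not_le by blast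

text \<open>Each of the \<open>l\<close> disjoint teeth has at least \<open>L ^ (k - 1)\<close>
  vertices. Level 0 is a single vertex whatever \<open>l\<close> is, hence the case
  distinction.\<close>

lemma card_comb_ge: "r > 0 \<Longrightarrow> (if k = 0 then 1 else l * L ^ (k - 1)) \<le> card (comb L k l r)"
proof (induction L k l r rule: comb.induct)
  case (3 L k l r)
  have "card (comb L (Suc k) (Suc l) r)
      = Suc (card (comb L k L (2 * r)) + card (comb L (Suc k) l (2 * r + 1)))"
    using \<open>r > 0\<close> comb_disjoint[of r L k L L "Suc k" l]
    by (simp add: root_notin_comb card_Un_disjoint)
  moreover have "L ^ k \<le> card (comb L k L (2 * r))"
    using "3.IH"(1) \<open>r > 0\<close> by (cases k) auto
  moreover have "l * L ^ k \<le> card (comb L (Suc k) l (2 * r + 1))"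
    using "3.IH"(2) by simp
  ultimately show ?case by simp
qed simp_all

lemma heap_closed_comb: "heap_closed (comb L k l 1)"
  using comb_ge[of 0 L k l 1] comb_parent[of _ L k l 1] by (auto simp: heap_closed_def)

section \<open>Pathwidth of iterated combs\<close>

text \<open>The interval condition in terms of lists: such a splitting passes easily through
  \<open>map\<close> and \<open>@\<close>, so indices are handled only once, in
  \<open>contiguous_interval\<close>.\<close>

definition contiguous :: "'v \<Rightarrow> 'v set list \<Rightarrow> bool" where
  "contiguous v Bs \<longleftrightarrow> (\<exists>xs ys zs. Bs = xs @ ys @ zs \<and>
     (\<forall>B\<in>set xs. v \<notin> B) \<and> (\<forall>B\<in>set ys. v \<in> B) \<and> (\<forall>B\<in>set zs. v \<notin> B))"

lemma contiguousI:
  assumes "Bs = xs @ ys @ zs"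
    and "\<forall>B\<in>set xs. v \<notin> B" "\<forall>B\<in>set ys. v \<in> B" "\<forall>B\<in>set zs. v \<notin> B"
  shows "contiguous v Bs"
  using assms unfolding contiguous_def by blast

lemma contiguousE:
  assumes "contiguous v Bs"
  obtains xs ys zs where "Bs = xs @ ys @ zs"
    and "\<forall>B\<in>set xs. v \<notin> B" "\<forall>B\<in>set ys. v \<in> B" "\<forall>B\<in>set zs. v \<notin> B"
  using assms unfolding contiguous_def by blast

lemma contiguous_interval:
  assumes "contiguous v Bs"
  shows "\<exists>a b. {i. i < length Bs \<and> v \<in> Bs ! i} = {a..b}"
proof -
  obtain xs ys zs where Bs: "Bs = xs @ ys @ zs"
    and mem: "\<forall>B\<in>set xs. v \<notin> B" "\<forall>B\<in>set ys. v \<in> B" "\<forall>B\<in>set zs. v \<notin> B"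
    by (rule contiguousE[OF assms])
  have x: "v \<notin> xs ! i" if "i < length xs" for i using mem(1) that by simp
  have y: "v \<in> ys ! i" if "i < length ys" for i using mem(2) that by simp
  have z: "v \<notin> zs ! i" if "i < length zs" for i using mem(3) that by simp
  have "i < length Bs \<and> v \<in> Bs ! i \<longleftrightarrow> i \<in> {length xs..<length xs + length ys}" for i
  proof -
    consider "i < length xs" | "length xs \<le> i" "i < length xs + length ys"
      | "length xs + length ys \<le> i" by linarith
    then show ?thesis
    proof cases
      case 1
      then show ?thesis using x[of i] by (simp add: Bs nth_append)
    next
      case 2
      then show ?thesis using y[of "i - length xs"] by (simp add: Bs nth_append less_diff_conv2)
    next
      case 3
      then show ?thesis using z[of "i - length xs - length ys"] by (auto simp: Bs nth_append)
    qed
  qed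
  then have "{i. i < length Bs \<and> v \<in> Bs ! i} = {length xs..<length xs + length ys}" by blast
  also have "\<exists>a b. {length xs..<length xs + length ys} = {a..b}"
  proof (cases ys)
    case Nil
    \<comment> \<open>An empty block corresponds to the empty interval
      \<open>{1..0}\<close>.\<close>
    then show ?thesis by (intro exI[of _ 1] exI[of _ 0]) simp
  next
    case (Cons a list)
    then show ?thesis
      by (intro exI[of _ "length xs"] exI[of _ "length xs + length list"]) auto
  qed
  finally show ?thesis .
qed

section \<open>An explicit path decomposition of the comb\<close>

lemma contiguous_singleton: "contiguous v [{v}]"
  by (rule contiguousI[of _ "[]" "[{v}]" "[]"]) simp_all

text \<open>The backbone vertex \<open>r\<close> stays in all bags of its tooth and is then handed
  over to the next backbone vertex in the bag \<open>{r, 2 * r + 1}\<close>. Each level thus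
  enlarges the bags by one vertex.\<close>

fun comb_bags :: "nat \<Rightarrow> nat \<Rightarrow> nat \<Rightarrow> nat \<Rightarrow> nat set list" where
  "comb_bags L 0 l r = [{r}]"
| "comb_bags L (Suc k) 0 r = [{r}]"
| "comb_bags L (Suc k) (Suc l) r =
     map (insert r) (comb_bags L k L (2 * r)) @ {r, 2 * r + 1} # comb_bags L (Suc k) l (2 * r + 1)"

lemma comb_bags_nonempty [simp]: "comb_bags L k l r \<noteq> []"
  by (induction L k l r rule: comb_bags.induct) auto

lemma Union_comb_bags: "\<Union>(set (comb_bags L k l r)) = comb L k l r"
proof (induction L k l r rule: comb_bags.induct)
  case (3 L k l r)
  have "\<Union>(set (map (insert r) (comb_bags L k L (2 * r)))) = insert r (comb L k L (2 * r))"
    using 3(1) comb_bags_nonempty[of L k L "2 * r"] by auto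
  then show ?case using 3(2) by (auto)
qed auto

lemma card_comb_bags: "B \<in> set (comb_bags L k l r) \<Longrightarrow> finite B \<and> card B \<le> Suc k"
proof (induction L k l r arbitrary: B rule: comb_bags.induct)
  case (3 L k l r)
  consider C where "B = insert r C" "C \<in> set (comb_bags L k L (2 * r))" | "B = {r, 2 * r + 1}"
    | "B \<in> set (comb_bags L (Suc k) l (2 * r + 1))"
    using "3.prems" by auto
  then show ?case
  proof cases
    case 1
    then show ?thesis using "3.IH"(1)[of C] by (auto simp: card_insert_if)
  qed (use "3.IH"(2) in \<open>auto simp: card_insert_if\<close>)
qed auto

lemma comb_bags_edge:
  "v \<in> comb L k l r \<Longrightarrow> v \<noteq> r \<Longrightarrow> \<exists>B\<in>set (comb_bags L k l r). {v, v div 2} \<subseteq> B"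
proof (induction L k l r rule: comb_bags.induct)
  case (3 L k l r)
  consider "v = 2 * r" | "v \<in> comb L k L (2 * r)" "v \<noteq> 2 * r" | "v = 2 * r + 1"
    | "v \<in> comb L (Suc k) l (2 * r + 1)" "v \<noteq> 2 * r + 1"
    using "3.prems" by auto
  then show ?case
  proof cases
    case 1
    obtain B where "B \<in> set (comb_bags L k L (2 * r))" "2 * r \<in> B"
      using Union_comb_bags[of L k L "2 * r"] root_in_comb by blast
    then show ?thesis using 1 by (intro bexI[of _ "insert r B"]) simp_all
  next
    case 2
    then obtain B where "B \<in> set (comb_bags L k L (2 * r))" "{v, v div 2} \<subseteq> B"
      using "3.IH"(1) by blast
    then show ?thesis by (intro bexI[of _ "insert r B"]) auto
  next
    case 3
    then show ?thesis by (intro bexI[of _ "{r, 2 * r + 1}"]) simp_all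
  next
    case 4
    then obtain B where "B \<in> set (comb_bags L (Suc k) l (2 * r + 1))" "{v, v div 2} \<subseteq> B"
      using "3.IH"(2) by blast
    then show ?thesis by (intro bexI[of _ B]) simp_all
  qed
qed auto

text \<open>The root fills an initial block of bags, so that it stays contiguous when the handover
  bag is put in front.\<close>

lemma comb_bags_root:
  assumes "r > 0"
  obtains ys zs where "comb_bags L k l r = ys @ zs"
    "\<forall>B\<in>set ys. r \<in> B" "\<forall>B\<in>set zs. r \<notin> B"
proof (cases "k = 0 \<or> l = 0")
  case True
  then have "comb_bags L k l r = [{r}] @ []" by (cases k; cases l) simp_all
  then show thesis by (rule that) simp_all
next
  case False
  then obtain k' l' where "k = Suc k'" "l = Suc l'" by (metis not0_implies_Suc)
  then have "comb_bags L k l r = (map (insert r) (comb_bags L k' L (2 * r)) @ [{r, 2 * r + 1}]) @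
      comb_bags L (Suc k') l' (2 * r + 1)" by simp
  moreover have "\<forall>B\<in>set (comb_bags L (Suc k') l' (2 * r + 1)). r \<notin> B"
    using Union_comb_bags[of L "Suc k'" l' "2 * r + 1"]
      root_notin_comb[of r "2 * r + 1" L "Suc k'" l'] by auto
  ultimately show thesis by (intro that) auto
qed

text \<open>By disjointness a vertex other than \<open>r\<close> occurs only in the tooth or only in
  the rest of the backbone; the one addition is \<open>2 * r + 1\<close> in the handover bag, which
  adjoins its initial block.\<close>

lemma contiguous_comb_bags:
  "r > 0 \<Longrightarrow> v \<in> comb L k l r \<Longrightarrow> contiguous v (comb_bags L k l r)"
proof (induction L k l r rule: comb_bags.induct)
  case (3 L k l r)
  let ?X = "comb_bags L k L (2 * r)" and ?Y = "comb_bags L (Suc k) l (2 * r + 1)"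
  have UX: "\<Union>(set ?X) = comb L k L (2 * r)" and UY: "\<Union>(set ?Y) = comb L (Suc k) l (2 * r + 1)"
    by (rule Union_comb_bags)+
  have disj: "comb L k L (2 * r) \<inter> comb L (Suc k) l (2 * r + 1) = {}"
    using comb_disjoint \<open>r > 0\<close> by blast
  consider "v = r" | "v \<noteq> r" "v \<in> comb L k L (2 * r)" | "v = 2 * r + 1"
    | "v \<noteq> r" "v \<in> comb L (Suc k) l (2 * r + 1)" "v \<noteq> 2 * r + 1"
    using "3.prems" by auto
  then show ?case
  proof cases
    case 1
    obtain ys zs where "comb_bags L (Suc k) (Suc l) r = ys @ zs"
      "\<forall>B\<in>set ys. r \<in> B" "\<forall>B\<in>set zs. r \<notin> B"
      by (rule comb_bags_root[OF \<open>r > 0\<close>])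
    then show ?thesis using 1 by (intro contiguousI[of _ "[]" ys zs]) simp_all
  next
    case 2
    have "contiguous v ?X" using "3.IH"(1) 2 \<open>r > 0\<close> by simp
    then obtain xs ys zs where X: "?X = xs @ ys @ zs"
      "\<forall>B\<in>set xs. v \<notin> B" "\<forall>B\<in>set ys. v \<in> B" "\<forall>B\<in>set zs. v \<notin> B"
      by (rule contiguousE)
    have Y: "\<forall>B\<in>set ?Y. v \<notin> B" "v \<noteq> 2 * r + 1"
      using 2 disj UY root_in_comb[of "2 * r + 1" L "Suc k" l] by blast+
    show ?thesis
      by (rule contiguousI[of _ "map (insert r) xs" "map (insert r) ys"
            "map (insert r) zs @ {r, 2 * r + 1} # ?Y"])
        (use 2 X Y in \<open>simp_all add: ball_Un\<close>)
  next
    case 3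
    obtain ys zs where Y: "?Y = ys @ zs" "\<forall>B\<in>set ys. v \<in> B" "\<forall>B\<in>set zs. v \<notin> B"
      unfolding 3 by (rule comb_bags_root[of "2 * r + 1" L "Suc k" l]) simp
    have X: "\<forall>B\<in>set ?X. v \<notin> B" "v \<noteq> r"
      using 3 disj UX root_in_comb[of "2 * r + 1" L "Suc k" l] by (blast, simp)
    show ?thesis
      by (rule contiguousI[of _ "map (insert r) ?X" "{r, 2 * r + 1} # ys" zs])
        (use 3 X Y in \<open>simp_all add: ball_Un\<close>)
  next
    case 4
    have "contiguous v ?Y" using "3.IH"(2) 4 by simp
    then obtain xs ys zs where Y: "?Y = xs @ ys @ zs"
      "\<forall>B\<in>set xs. v \<notin> B" "\<forall>B\<in>set ys. v \<in> B" "\<forall>B\<in>set zs. v \<notin> B"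
      by (rule contiguousE)
    have X: "\<forall>B\<in>set ?X. v \<notin> B" using 4 disj UX by blast
    show ?thesis
      by (rule contiguousI[of _ "map (insert r) ?X @ {r, 2 * r + 1} # xs" ys zs])
        (use 4 X Y in \<open>simp_all add: ball_Un\<close>)
  qed
next
  case (1 L l r)
  then show ?case using contiguous_singleton by simp
next
  case (2 L k r)
  then show ?case using contiguous_singleton by simp
qed

lemma path_decomposition_comb_bags:
  "path_decomposition (heap_graph (comb L k l 1)) (comb_bags L k l 1)"
  unfolding path_decomposition_def
proof (intro conjI ballI)
  fix e assume "e \<in> edges (heap_graph (comb L k l 1))"
  then obtain v where v: "e = {v, v div 2}" "v \<in> comb L k l 1" "v div 2 \<in> comb L k l 1"
    by (auto simp: heap_graph_def)
  then have "v \<noteq> 1" using comb_ge by fastforce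
  then show "\<exists>B\<in>set (comb_bags L k l 1). e \<subseteq> B" using comb_bags_edge v by metis
next
  fix v assume "v \<in> verts (heap_graph (comb L k l 1))"
  then have "contiguous v (comb_bags L k l 1)" by (intro contiguous_comb_bags) simp_all
  then show "\<exists>a b. {i. i < length (comb_bags L k l 1) \<and> v \<in> comb_bags L k l 1 ! i} = {a..b}"
    by (rule contiguous_interval)
qed (simp add: Union_comb_bags)

lemma comb_bags_width: "decomposition_width (comb_bags L k l r) \<le> k"
proof -
  have "Max (card ` set (comb_bags L k l r)) \<le> Suc k"
    using card_comb_bags by (subst Max_le_iff) auto
  then show ?thesis unfolding decomposition_width_def by linarith
qed

section \<open>Lower bound for every path decomposition\<close>

definition traverses :: "'v set list \<Rightarrow> 'v set \<Rightarrow> bool" where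
  "traverses Bs W \<longleftrightarrow> (\<forall>i j m. i \<le> j \<longrightarrow> j \<le> m \<longrightarrow> m < length Bs \<longrightarrow>
     Bs ! i \<inter> W \<noteq> {} \<longrightarrow> Bs ! m \<inter> W \<noteq> {} \<longrightarrow> Bs ! j \<inter> W \<noteq> {})"

lemma traverses_singleton:
  assumes "path_decomposition G Bs" "v \<in> verts G"
  shows "traverses Bs {v}"
proof -
  obtain a b where ab: "{i. i < length Bs \<and> v \<in> Bs ! i} = {a..b}"
    using assms unfolding path_decomposition_def by blast
  have "v \<in> Bs ! j" if "i \<le> j" "j \<le> m" "m < length Bs" "v \<in> Bs ! i" "v \<in> Bs ! m" for i j m
  proof -
    have "i \<in> {a..b}" "m \<in> {a..b}" unfolding ab[symmetric] using that by auto
    then have "j \<in> {a..b}" using that by auto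
    then show ?thesis unfolding ab[symmetric] by simp
  qed
  then show ?thesis by (auto simp: traverses_def)
qed

text \<open>Two runs of bags that share bag \<open>e\<close> form one run: if
  \<open>j \<le> e\<close>, the set met by bag \<open>i\<close> is met all the way to
  \<open>e\<close>, otherwise the set met by bag \<open>m\<close> is met all the way back to
  \<open>e\<close>.\<close>

lemma traverses_Un:
  assumes "traverses Bs W" "traverses Bs W'" "e < length Bs" "Bs ! e \<inter> W \<noteq> {}" "Bs ! e \<inter> W' \<noteq> {}"
  shows "traverses Bs (W \<union> W')"
  unfolding traverses_def
proof (intro allI impI)
  fix i j m
  assume ij: "i \<le> j" "j \<le> m" "m < length Bs"
    and meets: "Bs ! i \<inter> (W \<union> W') \<noteq> {}" "Bs ! m \<inter> (W \<union> W') \<noteq> {}"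
  have W: "\<lbrakk>i' \<le> j; j \<le> m'; m' < length Bs; Bs ! i' \<inter> W \<noteq> {}; Bs ! m' \<inter> W \<noteq> {}\<rbrakk>
      \<Longrightarrow> Bs ! j \<inter> W \<noteq> {}"
    and W': "\<lbrakk>i' \<le> j; j \<le> m'; m' < length Bs; Bs ! i' \<inter> W' \<noteq> {}; Bs ! m' \<inter> W' \<noteq> {}\<rbrakk>
      \<Longrightarrow> Bs ! j \<inter> W' \<noteq> {}" for i' m'
    using assms(1,2) unfolding traverses_def by blast+
  have "Bs ! j \<inter> W \<noteq> {} \<or> Bs ! j \<inter> W' \<noteq> {}"
  proof (cases "j \<le> e")
    case True
    have "Bs ! i \<inter> W \<noteq> {} \<or> Bs ! i \<inter> W' \<noteq> {}" using meets(1) by blast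
    then show ?thesis using W[OF ij(1) True assms(3) _ assms(4)] W'[OF ij(1) True assms(3) _ assms(5)]
      by blast
  next
    case False
    then have "e \<le> j" by simp
    have "Bs ! m \<inter> W \<noteq> {} \<or> Bs ! m \<inter> W' \<noteq> {}" using meets(2) by blast
    then show ?thesis using W[OF \<open>e \<le> j\<close> ij(2,3) assms(4)] W'[OF \<open>e \<le> j\<close> ij(2,3) assms(5)]
      by blast
  qed
  then show "Bs ! j \<inter> (W \<union> W') \<noteq> {}" by blast
qed

lemma traverses_Un_edge:
  assumes "path_decomposition G Bs" "traverses Bs W" "traverses Bs W'"
    and "{u, v} \<in> edges G" "u \<in> W" "v \<in> W'"
  shows "traverses Bs (W \<union> W')"
proof -
  obtain e where "e < length Bs" "{u, v} \<subseteq> Bs ! e"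
    using assms(1,4) unfolding path_decomposition_def by (metis in_set_conv_nth)
  then show ?thesis using assms by (intro traverses_Un[of Bs W W' e]) auto
qed

text \<open>The bags meeting a connected set form an interval; here the comb is assembled along the
  two edges from \<open>r\<close> to its children.\<close>

lemma traverses_comb:
  assumes "path_decomposition (heap_graph U) Bs"
  shows "comb L k l r \<subseteq> U \<Longrightarrow> traverses Bs (comb L k l r)"
proof (induction L k l r rule: comb.induct)
  case (3 L k l r)
  then have sub: "r \<in> U" "comb L k L (2 * r) \<subseteq> U" "comb L (Suc k) l (2 * r + 1) \<subseteq> U" by auto
  then have mem: "2 * r \<in> U" "2 * r + 1 \<in> U"
    using root_in_comb[of "2 * r" L k L] root_in_comb[of "2 * r + 1" L "Suc k" l] by blast+
  have "traverses Bs ({r} \<union> comb L k L (2 * r))"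
    using sub mem "3.IH"(1)
    by (intro traverses_Un_edge[OF assms traverses_singleton[OF assms], where u = r and v = "2 * r"])
      (auto simp: edge_heap_graph_iff)
  then have "traverses Bs (({r} \<union> comb L k L (2 * r)) \<union> comb L (Suc k) l (2 * r + 1))"
    using sub mem "3.IH"(2)
    by (intro traverses_Un_edge[OF assms, of "{r} \<union> comb L k L (2 * r)" _ r "2 * r + 1"])
      (auto simp: edge_heap_graph_iff)
  then show ?case by simp
qed (auto intro: traverses_singleton[OF assms])

text \<open>The middle bag also meets \<open>W\<close>, and a vertex found there lies outside
  \<open>Y\<close>, which raises the count by one.\<close>

lemma card_median_bag:
  assumes "traverses Bs W" "W \<inter> Y = {}" "W \<union> Y \<subseteq> V" "finite V"
    and "i \<le> j" "j \<le> m" "m < length Bs" "Bs ! i \<inter> W \<noteq> {}" "Bs ! m \<inter> W \<noteq> {}"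
    and "n \<le> card (Bs ! j \<inter> Y)"
  shows "Suc n \<le> card (Bs ! j \<inter> V)"
proof -
  obtain w where w: "w \<in> Bs ! j \<inter> W"
    using assms(1,5-9) unfolding traverses_def by (meson all_not_in_conv)
  have fin: "finite (Bs ! j \<inter> Y)" using assms(3,4) by (meson finite_Int finite_subset le_supE)
  have "Suc (card (Bs ! j \<inter> Y)) = card (insert w (Bs ! j \<inter> Y))"
    using w assms(2) fin by (subst card_insert_disjoint) auto
  also have "\<dots> \<le> card (Bs ! j \<inter> V)"
    using w assms(3,4) by (intro card_mono) auto
  finally show ?thesis using assms(10) by simp
qed

text \<open>Each of three copies of the comb of level \<open>k\<close> fills some bag. The bag that lies between
  the other two must contain one more vertex, on the connection between the two outer copies
  through the backbone.\<close>

lemma comb_large_bag: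
  assumes "path_decomposition (heap_graph U) Bs" "3 \<le> L"
  shows "0 < r \<Longrightarrow> comb L k L r \<subseteq> U \<Longrightarrow> \<exists>j<length Bs. Suc k \<le> card (Bs ! j \<inter> comb L k L r)"
proof (induction k arbitrary: r)
  case 0
  then obtain j where "j < length Bs" "r \<in> Bs ! j"
    using assms(1) unfolding path_decomposition_def
    by (metis Union_iff comb.simps(1) in_set_conv_nth insert_subset verts_heap_graph)
  then show ?case by (intro exI[of _ j]) auto
next
  case (Suc k)
  obtain l where L: "L = Suc (Suc (Suc l))"
    using assms(2) by (metis Suc_le_D numeral_3_eq_3 Suc_le_mono)
  define r2 r3 where "r2 = 2 * r + 1" and "r3 = 2 * r2 + 1"
  define V where "V = comb L (Suc k) L r"
  \<comment> \<open>\<open>H\<close> is the stretch of backbone that connects the three teeth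
    \<open>X\<close>, \<open>Y\<close> and \<open>Z\<close>. Any two teeth together with
    \<open>H\<close> form a connected set that avoids the third.\<close>
  define H where "H = {r, r2, r3}"
  define X where "X = comb L k L (2 * r)"
  define Y where "Y = comb L k L (2 * r2)"
  define Z where "Z = comb L k L (2 * r3)"
  let ?W2 = "comb L (Suc k) (Suc (Suc l)) r2" and ?W3 = "comb L (Suc k) (Suc l) r3"
  have V: "V = insert r (X \<union> ?W2)" and W2: "?W2 = insert r2 (Y \<union> ?W3)"
    and W3: "?W3 = insert r3 (Z \<union> comb L (Suc k) l (2 * r3 + 1))"
    unfolding V_def X_def Y_def Z_def r2_def r3_def
    by (subst L, simp only: comb.simps)+
  have r: "0 < r" "r < r2" "r2 < r3" using Suc.prems by (auto simp: r2_def r3_def)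
  have XW: "X \<inter> ?W2 = {}" and YW: "Y \<inter> ?W3 = {}"
    using comb_disjoint[OF r(1), of L k L L "Suc k" "Suc (Suc l)"]
      comb_disjoint[of r2 L k L L "Suc k" "Suc l"] r
    by (simp_all only: X_def Y_def r2_def r3_def)
  have disj: "X \<inter> Y = {}" "X \<inter> Z = {}" "Y \<inter> Z = {}" using XW YW W2 W3 by blast+
  have "r2 \<notin> X" "r3 \<notin> X" "r3 \<notin> Y" using XW YW W2 W3 by blast+
  moreover have "r \<notin> X" "r \<notin> Y" "r \<notin> Z" "r2 \<notin> Y" "r2 \<notin> Z" "r3 \<notin> Z"
    using r unfolding X_def Y_def Z_def by (auto intro!: root_notin_comb)
  ultimately have Hdisj: "H \<inter> X = {}" "H \<inter> Y = {}" "H \<inter> Z = {}" by (auto simp: H_def)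
  have sub: "H \<subseteq> V" "X \<subseteq> V" "Y \<subseteq> V" "Z \<subseteq> V" using V W2 W3 by (auto simp: H_def)
  have VU: "V \<subseteq> U" using Suc.prems by (simp add: V_def)
  have XU: "X \<subseteq> U" and YU: "Y \<subseteq> U" and ZU: "Z \<subseteq> U" and HU: "r \<in> U" "r2 \<in> U" "r3 \<in> U"
    using sub VU by (auto simp: H_def)
  have roots: "2 * r \<in> X" "2 * r2 \<in> Y" "2 * r3 \<in> Z" by (simp_all add: X_def Y_def Z_def)
  have tr: "traverses Bs X" "traverses Bs Y" "traverses Bs Z"
    using traverses_comb[OF assms(1)] XU YU ZU unfolding X_def Y_def Z_def by blast+
  have sing: "traverses Bs {v}" if "v \<in> U" for v using traverses_singleton[OF assms(1)] that by simp
  note join = traverses_Un_edge[OF assms(1)]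
  have "traverses Bs ({r} \<union> {r2})"
    by (rule join[OF sing sing, of r r2 r r2]) (use HU in \<open>auto simp: edge_heap_graph_iff r2_def\<close>)
  then have "traverses Bs (({r} \<union> {r2}) \<union> {r3})"
    by (rule join[OF _ sing, of _ r3 r2 r3]) (use HU in \<open>auto simp: edge_heap_graph_iff r3_def\<close>)
  then have trH: "traverses Bs H" by (simp add: H_def Un_commute insert_commute)
  have addX: "traverses Bs (W \<union> X)" if "traverses Bs W" "H \<subseteq> W" for W
    by (rule join[OF that(1) tr(1), of r "2 * r"])
      (use that(2) HU XU roots in \<open>auto simp: edge_heap_graph_iff H_def\<close>)
  have addY: "traverses Bs (W \<union> Y)" if "traverses Bs W" "H \<subseteq> W" for W
    by (rule join[OF that(1) tr(2), of r2 "2 * r2"])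
      (use that(2) HU YU roots in \<open>auto simp: edge_heap_graph_iff H_def\<close>)
  have addZ: "traverses Bs (W \<union> Z)" if "traverses Bs W" "H \<subseteq> W" for W
    by (rule join[OF that(1) tr(3), of r3 "2 * r3"])
      (use that(2) HU ZU roots in \<open>auto simp: edge_heap_graph_iff H_def\<close>)
  have trXY: "traverses Bs (H \<union> X \<union> Y)" and trXZ: "traverses Bs (H \<union> X \<union> Z)"
    and trYZ: "traverses Bs (H \<union> Y \<union> Z)"
    using addX[OF trH] addY[OF trH] by (auto intro: addY addZ)
  obtain x where x: "x < length Bs" "Suc k \<le> card (Bs ! x \<inter> X)"
    using Suc.IH[of "2 * r"] r XU unfolding X_def by auto
  obtain y where y: "y < length Bs" "Suc k \<le> card (Bs ! y \<inter> Y)"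
    using Suc.IH[of "2 * r2"] r YU unfolding Y_def by auto
  obtain z where z: "z < length Bs" "Suc k \<le> card (Bs ! z \<inter> Z)"
    using Suc.IH[of "2 * r3"] r ZU unfolding Z_def by auto
  have ne: "Bs ! x \<inter> X \<noteq> {}" "Bs ! y \<inter> Y \<noteq> {}" "Bs ! z \<inter> Z \<noteq> {}"
    using x y z by auto
  have finV: "finite V" by (simp add: V_def)
  have medZ: "Suc (Suc k) \<le> card (Bs ! z \<inter> V)" if "x \<le> z \<and> z \<le> y \<or> y \<le> z \<and> z \<le> x"
    using that
  proof
    assume "x \<le> z \<and> z \<le> y"
    then show ?thesis
      using trXY disj Hdisj sub finV x y z ne
      by (intro card_median_bag[of Bs "H \<union> X \<union> Y" Z V x z y]) auto
  next
    assume "y \<le> z \<and> z \<le> x"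
    then show ?thesis
      using trXY disj Hdisj sub finV x y z ne
      by (intro card_median_bag[of Bs "H \<union> X \<union> Y" Z V y z x]) auto
  qed
  have medY: "Suc (Suc k) \<le> card (Bs ! y \<inter> V)" if "x \<le> y \<and> y \<le> z \<or> z \<le> y \<and> y \<le> x"
    using that
  proof
    assume "x \<le> y \<and> y \<le> z"
    then show ?thesis
      using trXZ disj Hdisj sub finV x y z ne
      by (intro card_median_bag[of Bs "H \<union> X \<union> Z" Y V x y z]) auto
  next
    assume "z \<le> y \<and> y \<le> x"
    then show ?thesis
      using trXZ disj Hdisj sub finV x y z ne
      by (intro card_median_bag[of Bs "H \<union> X \<union> Z" Y V z y x]) auto
  qed
  have medX: "Suc (Suc k) \<le> card (Bs ! x \<inter> V)" if "y \<le> x \<and> x \<le> z \<or> z \<le> x \<and> x \<le> y"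
    using that
  proof
    assume "y \<le> x \<and> x \<le> z"
    then show ?thesis
      using trYZ disj Hdisj sub finV x y z ne
      by (intro card_median_bag[of Bs "H \<union> Y \<union> Z" X V y x z]) auto
  next
    assume "z \<le> x \<and> x \<le> y"
    then show ?thesis
      using trYZ disj Hdisj sub finV x y z ne
      by (intro card_median_bag[of Bs "H \<union> Y \<union> Z" X V z x y]) auto
  qed
  \<comment> \<open>One of three positions always lies between the other two, ties included.\<close>
  have "(x \<le> z \<and> z \<le> y \<or> y \<le> z \<and> z \<le> x) \<or> (x \<le> y \<and> y \<le> z \<or> z \<le> y \<and> y \<le> x)
    \<or> (y \<le> x \<and> x \<le> z \<or> z \<le> x \<and> x \<le> y)" by linarith
  then show ?case using medX medY medZ x y z unfolding V_def by metis
qed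

lemma pathwidth_comb:
  assumes "3 \<le> L"
  shows "pathwidth (heap_graph (comb L k L 1)) = k"
proof -
  let ?G = "heap_graph (comb L k L 1)"
  have lower: "k \<le> decomposition_width Bs" if pd: "path_decomposition ?G Bs" for Bs
  proof -
    obtain j where j: "j < length Bs" "Suc k \<le> card (Bs ! j \<inter> comb L k L 1)"
      using comb_large_bag[OF pd assms, of 1 k] by auto
    have "Bs ! j \<subseteq> comb L k L 1"
      using pd j(1) unfolding path_decomposition_def by (metis Union_upper nth_mem verts_heap_graph)
    then have "Suc k \<le> card (Bs ! j)" using j(2) by (simp add: Int_absorb2)
    also have "\<dots> \<le> Max (card ` set Bs)" using j(1) by (intro Max_ge) auto
    finally show ?thesis by (simp add: decomposition_width_def)
  qed
  \<comment> \<open>\<open>pathwidth\<close> is the least width attained, so the width of this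
    decomposition must be exactly \<open>k\<close>.\<close>
  have "decomposition_width (comb_bags L k L 1) = k"
    using comb_bags_width lower[OF path_decomposition_comb_bags] by (simp add: le_antisym)
  then show ?thesis unfolding pathwidth_def
    using path_decomposition_comb_bags lower by (intro Least_equality) blast+
qed

section \<open>The lower bound\<close>

text \<open>The prediction is the root and the target is found by averaging over \<open>S\<close>.
  The constant is \<open>64 = 2 * 8 * 2 * 2\<close>: passing from \<open>card S\<close> to
  \<open>L ^ k\<close>, the bound on \<open>ln 9\<close>, strictness in the averaging, and
  \<open>ln dist \<le> 2 * ln L\<close>.\<close>

lemma expected_queries_comb_ge:
  assumes alg: "zero_error_algorithm M (A :: ('r, nat) algorithm)" and k: "1 \<le> k"
  obtains T s t where "is_tree T" "pathwidth T = k" "s \<in> verts T" "t \<in> verts T"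
    "D \<le> tree_dist T s t"
    "ennreal (real k * ln (real (tree_dist T s t)) / 64) < expected_queries M A T s t"
proof -
  \<comment> \<open>The extra 1 makes the distance positive, as monotonicity of \<open>ln\<close>
    requires.\<close>
  define D' where "D' = D + 1"
  \<comment> \<open>\<open>4\<close> gives \<open>2 * ln 2 \<le> ln L\<close> and three teeth,
    \<open>4 + k\<close> gives \<open>(k + 1) * L \<le> L * L\<close>, and the power of two ensures
    that the vertices near the root number at most half of \<open>L ^ k\<close>.\<close>
  define L where "L = 4 + k + 2 ^ Suc D'"
  define U where "U = comb L k L 1"
  define S where "S = {v \<in> U. 2 ^ D' \<le> v}"
  let ?T = "heap_graph U"
  have hc: "heap_closed U" unfolding U_def by (rule heap_closed_comb)
  have tree: "is_tree ?T" and root: "1 \<in> verts ?T"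
    using is_tree_heap_graph[OF hc] hc by (auto simp: heap_closed_def)
  have pw: "pathwidth ?T = k" unfolding U_def by (rule pathwidth_comb) (simp add: L_def)
  have finU: "finite U" by (simp add: U_def)
  have dist: "D' \<le> tree_dist ?T 1 t" "tree_dist ?T 1 t \<le> L\<^sup>2" if "t \<in> S" for t
  proof -
    have tU: "t \<in> U" and "2 ^ D' \<le> t" using that by (auto simp: S_def)
    have "(2::nat) ^ D' < 2 ^ Suc (tree_dist ?T 1 t)"
      using tree_dist_root_bounds(2)[OF hc tU] \<open>2 ^ D' \<le> t\<close> by linarith
    then show "D' \<le> tree_dist ?T 1 t" by (metis less_Suc_eq_le one_less_numeral_iff power_less_imp_less_exp semiring_norm(76))
    have "t < (1 + 1) * 2 ^ (k * L + L)" using tU unfolding U_def by (rule comb_lt)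
    then have "(2::nat) ^ tree_dist ?T 1 t < 2 ^ Suc (k * L + L)"
      using tree_dist_root_bounds(1)[OF hc tU] by simp
    then have "tree_dist ?T 1 t \<le> (k + 1) * L" by (simp del: power_Suc add: less_Suc_eq_le)
    also have "\<dots> \<le> L * L" by (rule mult_le_mono1) (simp add: L_def)
    finally show "tree_dist ?T 1 t \<le> L\<^sup>2" by (simp add: power2_eq_square)
  qed
  have "L ^ k \<le> card U"
    using card_comb_ge[of 1 k L L] k by (cases k) (auto simp: U_def)
  also have "card U \<le> card S + card {..<(2::nat) ^ D'}"
    using finU by (intro order.trans[OF card_mono card_Un_le]) (auto simp: S_def)
  finally have "L ^ k \<le> card S + 2 ^ D'" by simp
  moreover have "2 * 2 ^ D' \<le> L ^ k"
    using self_le_power[of L k] k by (simp add: L_def)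
  ultimately have cardS: "L ^ k \<le> 2 * card S" by linarith
  have L4: "4 \<le> real L" by (simp add: L_def)
  then have lnL: "2 * ln 2 \<le> ln (real L)"
    using ln_le_cancel_iff[of 4 "real L"] ln_realpow[of 2 2] by (simp del: ln_le_cancel_iff)
  have lnL_pos: "0 < ln (real L)" using L4 by simp
  have cS: "0 < real (card S)" using cardS L4 by (cases "card S = 0") auto
  have "real k * ln (real L) - ln 2 \<le> ln (real (card S))"
  proof -
    have "real L ^ k \<le> 2 * real (card S)"
      using cardS by (metis of_nat_le_iff of_nat_mult of_nat_numeral of_nat_power)
    then have "ln (real L ^ k) \<le> ln (2 * real (card S))" using L4 cS by (subst ln_le_cancel_iff) auto
    then show ?thesis using L4 cS by (simp add: ln_realpow ln_mult)
  qed
  \<comment> \<open>Together with \<open>lnL\<close>, the loss of \<open>ln 2\<close> is at most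
    half of \<open>k * ln L\<close>.\<close>
  moreover have "1 * ln (real L) \<le> real k * ln (real L)"
    using k lnL_pos by (intro mult_right_mono) auto
  ultimately have lnS: "real k * ln (real L) / 2 \<le> ln (real (card S))" using lnL by linarith
  have ln9: "ln (real 9) \<le> 8" "0 < ln (real 9)" using ln_le_minus_one[of 9] by simp_all
  have klnL: "0 < real k * ln (real L)" using k lnL_pos by simp
  have resp: "\<exists>R. finite R \<and> card R \<le> 9 \<and> (\<forall>t. respond ?T t x \<in> R)" for x
    using heap_graph_responses[of U x] by metis
  have "ennreal (real (card S) * ln (real (card S)) / ln (real 9))
      \<le> (\<Sum>t\<in>S. expected_queries M A ?T 1 t)"
    by (rule total_expected_queries_ge[OF resp alg tree root]) (auto simp: S_def)
  moreover have "real (card S) * (real k * ln (real L) / 16)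
      \<le> real (card S) * ln (real (card S)) / ln (real 9)"
  proof -
    have "real k * ln (real L) / 16 * ln (real 9) \<le> real k * ln (real L) / 16 * 8"
      using ln9 klnL by (intro mult_left_mono) auto
    then have "real k * ln (real L) / 16 \<le> ln (real (card S)) / ln (real 9)"
      using lnS ln9 by (simp add: pos_le_divide_eq)
    then show ?thesis using cS mult_left_mono[of _ _ "real (card S)"] by fastforce
  qed
  ultimately have total: "ennreal (real (card S) * (real k * ln (real L) / 16))
      \<le> (\<Sum>t\<in>S. expected_queries M A ?T 1 t)"
    by (meson ennreal_leI order.trans)
  \<comment> \<open>Halving the average from \<open>1 / 16\<close> to \<open>1 / 32\<close> yields a
    strict inequality for some target.\<close>
  have "\<exists>t\<in>S. ennreal (real k * ln (real L) / 32) < expected_queries M A ?T 1 t"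
  proof (rule ccontr)
    assume "\<not> ?thesis"
    then have "(\<Sum>t\<in>S. expected_queries M A ?T 1 t) \<le> (\<Sum>t\<in>S. ennreal (real k * ln (real L) / 32))"
      by (intro sum_mono) (auto simp: not_less)
    also have "\<dots> = ennreal (real (card S) * (real k * ln (real L) / 32))"
      using klnL by (subst ennreal_mult) (simp_all add: ennreal_of_nat_eq_real_of_nat)
    also have "\<dots> < ennreal (real (card S) * (real k * ln (real L) / 16))"
      using klnL cS by (intro ennreal_lessI mult_pos_pos mult_strict_left_mono) auto
    finally show False using total by simp
  qed
  then obtain t where t: "t \<in> S"
    "ennreal (real k * ln (real L) / 32) < expected_queries M A ?T 1 t" by blast
  show thesis
  proof
    show "is_tree ?T" "pathwidth ?T = k" "1 \<in> verts ?T" by (fact tree pw root)+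
    show "t \<in> verts ?T" using t by (simp add: S_def)
    show "D \<le> tree_dist ?T 1 t" using dist(1)[OF t(1)] by (simp add: D'_def)
    have "0 < tree_dist ?T 1 t" using dist(1)[OF t(1)] by (simp add: D'_def)
    moreover have "real (tree_dist ?T 1 t) \<le> real L ^ 2"
      using dist(2)[OF t(1)] by (metis of_nat_le_iff of_nat_power)
    ultimately have "ln (real (tree_dist ?T 1 t)) \<le> ln (real L ^ 2)"
      using L4 by (subst ln_le_cancel_iff) auto
    also have "\<dots> = 2 * ln (real L)" using L4 by (simp add: ln_realpow)
    finally have "real k * ln (real (tree_dist ?T 1 t)) \<le> real k * (2 * ln (real L))"
      by (intro mult_left_mono) auto
    then have "ennreal (real k * ln (real (tree_dist ?T 1 t)) / 64) \<le> ennreal (real k * ln (real L) / 32)"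
      by (intro ennreal_leI) simp
    then show "ennreal (real k * ln (real (tree_dist ?T 1 t)) / 64) < expected_queries M A ?T 1 t"
      using t(2) by (rule order.strict_trans1)
  qed
qed

text \<open>The little-o condition is used only with the constant \<open>1 / 64\<close>, where combs
  of one fixed pathwidth from \<open>K\<close> already violate it at arbitrarily large
  distances.\<close>

theorem theorem3:
  fixes M :: "'r measure" and K :: "nat filter"
  assumes "K \<noteq> bot" and "\<forall>\<^sub>F k in K. 1 \<le> k"
  shows "\<not> (\<exists>A :: ('r, nat) algorithm.
           zero_error_algorithm M A \<and>
           complexity_little_o_k_log_dist M A (K \<times>\<^sub>F at_top))"
proof
  assume "\<exists>A :: ('r, nat) algorithm.
    zero_error_algorithm M A \<and> complexity_little_o_k_log_dist M A (K \<times>\<^sub>F at_top)"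
  then obtain A :: "('r, nat) algorithm" and g :: "nat \<times> nat \<Rightarrow> real"
    where alg: "zero_error_algorithm M A"
      and g: "g \<in> o[K \<times>\<^sub>F at_top](\<lambda>(k, d). real k * ln (real d))"
      and bound: "\<forall>\<^sub>F (k, d) in K \<times>\<^sub>F at_top. \<forall>T s t.
        is_tree T \<and> pathwidth T = k \<and> s \<in> verts T \<and> t \<in> verts T \<and> tree_dist T s t = d \<longrightarrow>
        expected_queries M A T s t \<le> ennreal (g (k, d))"
    unfolding complexity_little_o_k_log_dist_def by blast
  have small: "\<forall>\<^sub>F (k, d) in K \<times>\<^sub>F at_top. g (k, d) \<le> real k * ln (real d) / 64"
  proof (rule eventually_mono)
    show "\<forall>\<^sub>F x in K \<times>\<^sub>F at_top. norm (g x) \<le> 1 / 64 * norm (case x of (k, d) \<Rightarrow> real k * ln (real d))"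
      using landau_o.smallD[OF g, of "1 / 64"] by simp
    fix x :: "nat \<times> nat"
    assume *: "norm (g x) \<le> 1 / 64 * norm (case x of (k, d) \<Rightarrow> real k * ln (real d))"
    obtain k d where x: "x = (k, d)" by fastforce
    \<comment> \<open>For \<open>d = 0\<close> this rests on the default value
      \<open>ln 0 = 0\<close>.\<close>
    have "0 \<le> real k * ln (real d)" by (cases d) auto
    then show "case x of (k, d) \<Rightarrow> g (k, d) \<le> real k * ln (real d) / 64" using * by (simp add: x)
  qed
  \<comment> \<open>In the product filter the threshold for \<open>d\<close> does not depend on
    \<open>k\<close>, so \<open>k\<close> can be fixed first and \<open>D\<close> taken from
    \<open>Q\<close>.\<close>
  obtain P Q where P: "eventually P K" and Q: "eventually Q at_top"
    and PQ: "\<And>k d. P k \<Longrightarrow> Q d \<Longrightarrow> (\<forall>T s t.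
        is_tree T \<and> pathwidth T = k \<and> s \<in> verts T \<and> t \<in> verts T \<and> tree_dist T s t = d \<longrightarrow>
        expected_queries M A T s t \<le> ennreal (g (k, d))) \<and> g (k, d) \<le> real k * ln (real d) / 64"
    using eventually_conj[OF bound small] unfolding eventually_prod_filter prod.case by blast
  obtain k where k: "P k" "1 \<le> k"
    using eventually_happens[OF eventually_conj[OF P assms(2)]] assms(1) by auto
  obtain D where D: "\<And>d. D \<le> d \<Longrightarrow> Q d" using Q by (auto simp: eventually_at_top_linorder)
  obtain T s t where T: "is_tree T" "pathwidth T = k" "s \<in> verts T" "t \<in> verts T"
    and far: "D \<le> tree_dist T s t"
    and large: "ennreal (real k * ln (real (tree_dist T s t)) / 64) < expected_queries M A T s t"
    using expected_queries_comb_ge[OF alg k(2), of D] .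
  have "expected_queries M A T s t \<le> ennreal (g (k, tree_dist T s t))"
    using PQ[OF k(1) D[OF far]] T by blast
  also have "\<dots> \<le> ennreal (real k * ln (real (tree_dist T s t)) / 64)"
    using PQ[OF k(1) D[OF far]] by (intro ennreal_leI) blast
  finally show False using large by simp
qed

end
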